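(* Let $r\ge 2$, $d\ge 1$ be integers, $n=(r-1)(d+1)+1$, and let $A\subset\mathbb{R}^d$ be a set of $n$ points whose $dn$ coordinates are algebraically independent. Let $M\subset A$ be any subset (of any size) with $\operatorname{conv} M\cap\operatorname{conv}(A\setminus M)=\emptyset$. Then there is a partition $\{A_1,\ldots,A_r\}$ of $A$ and a solution $(z,\alpha)$, $z\in\mathbb{R}^d$, $\alpha:A\to\mathbb{R}$, of the system \[ z=\sum_{x\in A_j}\alpha(x)\,x \quad\text{and}\quad 1=\sum_{x\in A_j}\alpha(x)\qquad\text{for all } j\in[r], \] such that either $\alpha(x)<0$ if and only if $x\in M$, or $\alpha(x)<0$ if and only if $x\notin M$.
   Context: $[r]=\{1,\ldots,r\}$; $\operatorname{conv}$ denotes convex hull, with $\operatorname{conv}\emptyset=\emptyset$. *)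

theory Defs
  imports "HOL-Analysis.Analysis"
begin

text \<open>Algebraic independence over the rationals of the family of reals f i, i in I
  (I finite): no nonzero rational polynomial in the variables indexed by I vanishes.
  A polynomial is a finitely supported map c from exponent vectors (supported in I) to rationals.\<close>
definition alg_indep :: "('i \<Rightarrow> real) \<Rightarrow> 'i set \<Rightarrow> bool" where
  "alg_indep f I \<longleftrightarrow>
     (\<forall>c :: ('i \<Rightarrow> nat) \<Rightarrow> rat.
        finite {e. c e \<noteq> 0}
        \<and> (\<forall>e. c e \<noteq> 0 \<longrightarrow> (\<forall>i. i \<notin> I \<longrightarrow> e i = 0))
        \<and> (\<Sum>e\<in>{e. c e \<noteq> 0}. of_rat (c e) * (\<Prod>i\<in>I. f i ^ e i)) = 0
        \<longrightarrow> (\<forall>e. c e = 0))"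

end

theory Submission
  imports Defs
begin

text \<open>
  Choose an affine function that is negative on M and positive on \<open>A - M\<close>, and replace each
  point x by the vector \<open>\<plusminus>(x, 1)\<close>, with the minus sign for x in M; all these vectors lie in an
  open half-space. A conic version of Tverberg's theorem (Sarkaria's argument) partitions them into
  r classes whose cones share a nonzero vector \<open>(z, t)\<close>. By Caratheodory only \<open>d + 1\<close> points of
  each class are needed. If \<open>t = 0\<close> or if some weight vanished, the coordinates would satisfy an
  algebraic relation depending only on the class sizes; a special configuration with the same
  class sizes shows that the relation is nontrivial. Dividing the signed weights by t yields the
  required solution, and the sign of t decides which of the two alternatives holds.
\<close>

section \<open>Elimination and linear dependence\<close>

text \<open>The combined row has coefficient 0 at the pivot \<open>v\<close>, so \<open>v\<close>
  can be put back into the sum. Both inductions by elimination, over the number of equations and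
  over the set of unknowns, rest on this identity.\<close>

lemma sum_eliminate_pivot:
  fixes p q \<delta> :: "'u \<Rightarrow> real"
  assumes "finite U" "v \<in> U"
  shows "(\<Sum>u\<in>U - {v}. (p v * q u - q v * p u) * \<delta> u)
       = p v * (\<Sum>u\<in>U. q u * \<delta> u) - q v * (\<Sum>u\<in>U. p u * \<delta> u)"
proof -
  have "(\<Sum>u\<in>U - {v}. (p v * q u - q v * p u) * \<delta> u) = (\<Sum>u\<in>U. (p v * q u - q v * p u) * \<delta> u)"
    using assms by (simp add: sum.remove)
  then show ?thesis
    by (simp add: sum_distrib_left sum_subtractf algebra_simps)
qed

text \<open>Gaussian elimination: an equation with a nonzero coefficient at \<open>v\<close> removes
  \<open>v\<close> from the others, which costs one equation and one unknown and preserves the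
  strict inequality. An equation with zero coefficients only is dropped.\<close>

lemma underdetermined_system:
  fixes a :: "'e \<Rightarrow> 'u \<Rightarrow> real"
  assumes "finite E" "finite U" "card E < card U"
  shows "\<exists>\<delta>. (\<exists>u\<in>U. \<delta> u \<noteq> 0) \<and> (\<forall>e\<in>E. (\<Sum>u\<in>U. a e u * \<delta> u) = 0)"
  using assms
proof (induction E arbitrary: U a rule: finite_induct)
  case empty
  then have "U \<noteq> {}" by auto
  then show ?case by (intro exI[of _ "\<lambda>_. 1"]) auto
next
  case (insert e E)
  show ?case
  proof (cases "\<forall>u\<in>U. a e u = 0")
    case True
    have "card E < card U" using insert by simp
    then show ?thesis using insert.IH[of U a] insert.prems True by auto
  next
    case False
    then obtain v where v: "v \<in> U" "a e v \<noteq> 0" by blast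
    have "card E < card (U - {v})" using insert v by simp
    from insert.IH[OF _ this, of "\<lambda>f u. a e v * a f u - a f v * a e u"] insert.prems
    obtain \<delta> where nz: "\<exists>u\<in>U - {v}. \<delta> u \<noteq> 0"
      and \<delta>: "\<And>f. f \<in> E \<Longrightarrow> (\<Sum>u\<in>U - {v}. (a e v * a f u - a f v * a e u) * \<delta> u) = 0"
      by auto
    \<comment> \<open>The value at \<open>v\<close> is the one that solves equation
      \<open>e\<close>; the other equations then follow from their eliminated versions.\<close>
    define \<eta> where "\<eta> = \<delta>(v := - (\<Sum>u\<in>U - {v}. a e u * \<delta> u) / a e v)"
    have "(\<Sum>u\<in>U - {v}. a e u * \<eta> u) = (\<Sum>u\<in>U - {v}. a e u * \<delta> u)"
      by (rule sum.cong) (auto simp: \<eta>_def)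
    then have e: "(\<Sum>u\<in>U. a e u * \<eta> u) = 0"
      using v insert.prems by (simp add: sum.remove[of U v] \<eta>_def)
    have "(\<Sum>u\<in>U. a f u * \<eta> u) = 0" if "f \<in> E" for f
    proof -
      have "(\<Sum>u\<in>U - {v}. (a e v * a f u - a f v * a e u) * \<eta> u)
          = (\<Sum>u\<in>U - {v}. (a e v * a f u - a f v * a e u) * \<delta> u)"
        by (rule sum.cong) (auto simp: \<eta>_def)
      then show ?thesis
        using \<delta>[OF that] sum_eliminate_pivot[of U v "a e" "a f" \<eta>] e v insert.prems by simp
    qed
    moreover have "\<exists>u\<in>U. \<eta> u \<noteq> 0" using nz by (auto simp: \<eta>_def)
    ultimately show ?thesis using e by (intro exI[of _ \<eta>]) auto
  qed
qed

lemma linear_dependence_euclidean: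
  fixes u :: "'x \<Rightarrow> 'a::euclidean_space"
  assumes "finite B" "DIM('a) < card B"
  shows "\<exists>\<delta>. (\<exists>x\<in>B. \<delta> x \<noteq> 0) \<and> (\<Sum>x\<in>B. \<delta> x *\<^sub>R u x) = 0"
proof -
  obtain \<delta> where "\<exists>x\<in>B. \<delta> x \<noteq> 0" and *: "\<forall>b\<in>Basis. (\<Sum>x\<in>B. (u x \<bullet> b) * \<delta> x) = 0"
    using underdetermined_system[of "Basis :: 'a set" B "\<lambda>b x. u x \<bullet> b"] assms by auto
  moreover have "(\<Sum>x\<in>B. \<delta> x *\<^sub>R u x) = 0"
    using * by (subst euclidean_eq_iff) (simp add: inner_sum_left mult.commute)
  ultimately show ?thesis by blast
qed

text \<open>The ratio test of linear programming: \<open>t\<close> is the least ratio at which a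
  decreasing coordinate reaches 0.\<close>

lemma move_to_boundary:
  fixes \<gamma> \<delta> :: "'x \<Rightarrow> real"
  assumes "finite A" "\<And>x. x \<in> A \<Longrightarrow> \<gamma> x \<ge> 0" "\<exists>x\<in>A. \<delta> x < 0"
  shows "\<exists>t. (\<forall>x\<in>A. \<gamma> x + t * \<delta> x \<ge> 0) \<and> (\<exists>x\<in>A. \<delta> x < 0 \<and> \<gamma> x + t * \<delta> x = 0)"
proof -
  define N where "N = {x\<in>A. \<delta> x < 0}"
  have N: "finite N" "N \<noteq> {}" using assms by (auto simp: N_def)
  define t where "t = Min ((\<lambda>x. \<gamma> x / - \<delta> x) ` N)"
  have "t \<in> (\<lambda>x. \<gamma> x / - \<delta> x) ` N" unfolding t_def using N by (intro Min_in) auto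
  then obtain y where y: "y \<in> A" "\<delta> y < 0" "t = \<gamma> y / - \<delta> y" by (auto simp: N_def)
  have t: "t \<ge> 0" using y assms(2)[of y] by (simp add: divide_nonneg_neg)
  have "\<gamma> x + t * \<delta> x \<ge> 0" if "x \<in> A" for x
  proof (cases "\<delta> x < 0")
    case True
    then have "t \<le> \<gamma> x / - \<delta> x" unfolding t_def using N that by (intro Min_le) (auto simp: N_def)
    then show ?thesis using True by (simp add: field_simps)
  next
    case False
    then show ?thesis using t assms(2)[OF that] by simp
  qed
  moreover have "\<gamma> y + t * \<delta> y = 0" using y by (simp add: field_simps)
  ultimately show ?thesis using y by blast
qed

section \<open>Weighted class sums and their deviation from the average\<close>

text \<open>The conditional keeps the index set \<open>A\<close> the same for every class, which
  makes linearity, continuity and exchange of sums immediate.\<close>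

definition class_sum :: "'x set \<Rightarrow> ('x \<Rightarrow> 'a::real_vector) \<Rightarrow> ('x \<Rightarrow> nat) \<Rightarrow> ('x \<Rightarrow> real) \<Rightarrow> nat \<Rightarrow> 'a"
  where "class_sum A u \<phi> \<gamma> j = (\<Sum>x\<in>A. if \<phi> x = j then \<gamma> x *\<^sub>R u x else 0)"

lemma class_sum_eq: "finite A \<Longrightarrow> class_sum A u \<phi> \<gamma> j = (\<Sum>x\<in>{x\<in>A. \<phi> x = j}. \<gamma> x *\<^sub>R u x)"
  unfolding class_sum_def by (simp add: sum.inter_filter)

lemma class_sum_linear:
  "class_sum A u \<phi> (\<lambda>x. a * \<gamma> x + b * \<delta> x) j = a *\<^sub>R class_sum A u \<phi> \<gamma> j + b *\<^sub>R class_sum A u \<phi> \<delta> j"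
  unfolding class_sum_def scaleR_sum_right sum.distrib[symmetric]
  by (rule sum.cong) (auto simp: scaleR_add_left)

text \<open>The colourings need to agree only where the weight is nonzero. This is what allows
  points of weight zero to be recoloured freely.\<close>

lemma class_sum_cong:
  "(\<And>x. x \<in> A \<Longrightarrow> \<gamma> x = \<delta> x) \<Longrightarrow> (\<And>x. x \<in> A \<Longrightarrow> \<gamma> x \<noteq> 0 \<Longrightarrow> \<phi> x = \<psi> x)
   \<Longrightarrow> class_sum A u \<phi> \<gamma> j = class_sum A u \<psi> \<delta> j"
  unfolding class_sum_def by (rule sum.cong) (metis scale_eq_0_iff)+

lemma sum_inner_class_sum:
  fixes u :: "'x \<Rightarrow> 'a::real_inner"
  assumes "finite A" "\<And>x. x \<in> A \<Longrightarrow> \<phi> x \<in> {1..r}"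
  shows "(\<Sum>j\<in>{1..r}. q j \<bullet> class_sum A u \<phi> \<gamma> j) = (\<Sum>x\<in>A. \<gamma> x * (q (\<phi> x) \<bullet> u x))"
proof -
  have "(\<Sum>j\<in>{1..r}. q j \<bullet> class_sum A u \<phi> \<gamma> j)
      = (\<Sum>x\<in>A. \<Sum>j\<in>{1..r}. q j \<bullet> (if \<phi> x = j then \<gamma> x *\<^sub>R u x else 0))"
    unfolding class_sum_def inner_sum_right by (rule sum.swap)
  also have "\<dots> = (\<Sum>x\<in>A. \<gamma> x * (q (\<phi> x) \<bullet> u x))"
  proof (rule sum.cong[OF refl])
    fix x assume "x \<in> A"
    have "(\<Sum>j\<in>{1..r}. q j \<bullet> (if \<phi> x = j then \<gamma> x *\<^sub>R u x else 0))
        = (\<Sum>j\<in>{1..r}. if \<phi> x = j then \<gamma> x * (q j \<bullet> u x) else 0)"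
      by (rule sum.cong) auto
    then show "(\<Sum>j\<in>{1..r}. q j \<bullet> (if \<phi> x = j then \<gamma> x *\<^sub>R u x else 0)) = \<gamma> x * (q (\<phi> x) \<bullet> u x)"
      using assms(2)[OF \<open>x \<in> A\<close>] by (simp add: sum.delta')
  qed
  finally show ?thesis .
qed

text \<open>The deviation family is the image of the class sums in the quotient by the diagonal; its
  square sum is the function minimised in Sarkaria's proof of Tverberg's theorem.\<close>

definition deviation ::
  "'x set \<Rightarrow> ('x \<Rightarrow> 'a::real_vector) \<Rightarrow> nat \<Rightarrow> ('x \<Rightarrow> nat) \<Rightarrow> ('x \<Rightarrow> real) \<Rightarrow> nat \<Rightarrow> 'a"
  where "deviation A u r \<phi> \<gamma> j =
    class_sum A u \<phi> \<gamma> j - (1 / real r) *\<^sub>R (\<Sum>k\<in>{1..r}. class_sum A u \<phi> \<gamma> k)"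

definition spread :: "'x set \<Rightarrow> ('x \<Rightarrow> 'a::real_inner) \<Rightarrow> nat \<Rightarrow> ('x \<Rightarrow> nat) \<Rightarrow> ('x \<Rightarrow> real) \<Rightarrow> real"
  where "spread A u r \<phi> \<gamma> = (\<Sum>j\<in>{1..r}. deviation A u r \<phi> \<gamma> j \<bullet> deviation A u r \<phi> \<gamma> j)"

lemma deviation_linear:
  "deviation A u r \<phi> (\<lambda>x. a * \<gamma> x + b * \<delta> x) j = a *\<^sub>R deviation A u r \<phi> \<gamma> j + b *\<^sub>R deviation A u r \<phi> \<delta> j"
  unfolding deviation_def class_sum_linear sum.distrib
  by (simp add: algebra_simps scaleR_sum_right)

lemma deviation_cong:
  "(\<And>x. x \<in> A \<Longrightarrow> \<gamma> x = \<delta> x) \<Longrightarrow> (\<And>x. x \<in> A \<Longrightarrow> \<gamma> x \<noteq> 0 \<Longrightarrow> \<phi> x = \<psi> x)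
   \<Longrightarrow> deviation A u r \<phi> \<gamma> = deviation A u r \<psi> \<delta>"
  unfolding deviation_def
  by (intro ext arg_cong2[where f = minus] arg_cong2[where f = scaleR] sum.cong class_sum_cong refl)

lemma sum_deviation: "r \<ge> 1 \<Longrightarrow> (\<Sum>j\<in>{1..r}. deviation A u r \<phi> \<gamma> j) = 0"
  unfolding deviation_def sum_subtractf by (simp add: sum_constant_scaleR)

lemma deviation_eq_0:
  assumes "r \<ge> 1" "\<And>j. j \<in> {1..r} \<Longrightarrow> class_sum A u \<phi> \<gamma> j = w" "j \<in> {1..r}"
  shows "deviation A u r \<phi> \<gamma> j = 0"
  using assms unfolding deviation_def by (simp add: sum_constant_scaleR)

text \<open>A family \<open>q\<close> with sum zero is orthogonal to the diagonal, so the subtracted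
  average does not contribute.\<close>

lemma sum_inner_deviation:
  fixes u :: "'x \<Rightarrow> 'a::real_inner"
  assumes "finite A" "\<And>x. x \<in> A \<Longrightarrow> \<phi> x \<in> {1..r}" "(\<Sum>j\<in>{1..r}. q j) = 0"
  shows "(\<Sum>j\<in>{1..r}. q j \<bullet> deviation A u r \<phi> \<gamma> j) = (\<Sum>x\<in>A. \<gamma> x * (q (\<phi> x) \<bullet> u x))"
proof -
  have "(\<Sum>j\<in>{1..r}. q j \<bullet> deviation A u r \<phi> \<gamma> j) = (\<Sum>j\<in>{1..r}. q j \<bullet> class_sum A u \<phi> \<gamma> j)
      - (\<Sum>j\<in>{1..r}. q j) \<bullet> ((1 / real r) *\<^sub>R (\<Sum>k\<in>{1..r}. class_sum A u \<phi> \<gamma> k))"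
    unfolding deviation_def inner_diff_right sum_subtractf inner_sum_left ..
  then show ?thesis using assms sum_inner_class_sum[OF assms(1,2)] by simp
qed

section \<open>Minimising the spread over weights and colourings\<close>

lemma nonneg_of_quadratic_nonneg:
  fixes b c :: real
  assumes "\<And>\<epsilon>. 0 < \<epsilon> \<Longrightarrow> \<epsilon> \<le> 1 \<Longrightarrow> 0 \<le> 2 * \<epsilon> * b + \<epsilon>\<^sup>2 * c"
  shows "b \<ge> 0"
proof (rule ccontr)
  assume "\<not> b \<ge> 0"
  \<comment> \<open>Small enough that \<open>\<epsilon> * c\<close> is at most \<open>- b\<close>,
    which leaves at most \<open>b < 0\<close> after division by \<open>\<epsilon>\<close>.\<close>
  define \<epsilon> where "\<epsilon> = min 1 (- b / (\<bar>c\<bar> + 1))"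
  have \<epsilon>: "0 < \<epsilon>" "\<epsilon> \<le> 1" "\<epsilon> \<le> - b / (\<bar>c\<bar> + 1)"
    using \<open>\<not> b \<ge> 0\<close> by (auto simp: \<epsilon>_def divide_neg_pos)
  have "0 \<le> \<epsilon> * (2 * b + \<epsilon> * c)" using assms[OF \<epsilon>(1,2)] by (simp add: power2_eq_square algebra_simps)
  then have "0 \<le> 2 * b + \<epsilon> * c" using \<epsilon> by (simp add: zero_le_mult_iff)
  also have "\<epsilon> * c \<le> \<epsilon> * (\<bar>c\<bar> + 1)" using \<epsilon> by (intro mult_left_mono) auto
  also have "\<dots> \<le> - b" using \<epsilon>(3) by (simp add: field_simps)
  finally show False using \<open>\<not> b \<ge> 0\<close> by simp
qed

text \<open>The variational inequality for a nearest point to the origin, with families over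
  \<open>J\<close> read as vectors of a product space: the squared norm cannot have negative
  derivative at \<open>p\<close> in the direction \<open>e - p\<close>.\<close>

lemma nearest_point_inner_ge:
  fixes p e :: "'j \<Rightarrow> 'a::real_inner"
  assumes "\<And>\<epsilon>. 0 < \<epsilon> \<Longrightarrow> \<epsilon> \<le> 1 \<Longrightarrow> (\<Sum>j\<in>J. p j \<bullet> p j)
    \<le> (\<Sum>j\<in>J. ((1 - \<epsilon>) *\<^sub>R p j + \<epsilon> *\<^sub>R e j) \<bullet> ((1 - \<epsilon>) *\<^sub>R p j + \<epsilon> *\<^sub>R e j))"
  shows "(\<Sum>j\<in>J. p j \<bullet> p j) \<le> (\<Sum>j\<in>J. p j \<bullet> e j)"
proof -
  have "0 \<le> (\<Sum>j\<in>J. p j \<bullet> (e j - p j))"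
  proof (rule nonneg_of_quadratic_nonneg)
    fix \<epsilon> :: real assume \<epsilon>: "0 < \<epsilon>" "\<epsilon> \<le> 1"
    have "(\<Sum>j\<in>J. ((1 - \<epsilon>) *\<^sub>R p j + \<epsilon> *\<^sub>R e j) \<bullet> ((1 - \<epsilon>) *\<^sub>R p j + \<epsilon> *\<^sub>R e j))
      = (\<Sum>j\<in>J. p j \<bullet> p j + 2 * \<epsilon> * (p j \<bullet> (e j - p j)) + \<epsilon>\<^sup>2 * ((e j - p j) \<bullet> (e j - p j)))"
      by (rule sum.cong) (auto simp: algebra_simps inner_commute power2_eq_square)
    with assms[OF \<epsilon>] show "0 \<le> 2 * \<epsilon> * (\<Sum>j\<in>J. p j \<bullet> (e j - p j)) + \<epsilon>\<^sup>2 * (\<Sum>j\<in>J. (e j - p j) \<bullet> (e j - p j))"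
      by (simp add: sum.distrib sum_distrib_left)
  qed
  then show ?thesis by (simp add: inner_diff_right sum_subtractf)
qed

text \<open>For a fixed colouring the spread is a continuous function on a simplex of weights, which
  is compact.\<close>

lemma spread_attains_min:
  fixes u :: "'x \<Rightarrow> 'a::real_inner"
  assumes "finite A" "A \<noteq> {}"
  shows "\<exists>\<gamma>. (\<forall>x\<in>A. \<gamma> x \<ge> 0) \<and> sum \<gamma> A = 1 \<and>
    (\<forall>\<delta>. (\<forall>x\<in>A. \<delta> x \<ge> 0) \<and> sum \<delta> A = 1 \<longrightarrow> spread A u r \<phi> \<gamma> \<le> spread A u r \<phi> \<delta>)"
proof -
  \<comment> \<open>Weights are pinned to 0 outside \<open>A\<close>, so that \<open>S\<close> is
    compact in the product topology even if the type \<open>'x\<close> is infinite.\<close>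
  define S where "S = PiE UNIV (\<lambda>x. if x \<in> A then {0..1::real} else {0}) \<inter> {\<gamma>. sum \<gamma> A = 1}"
  have cont: "continuous_on T (\<lambda>\<gamma> :: 'x \<Rightarrow> real. \<gamma> x)" for T x
    by (rule continuous_on_product_then_coordinatewise) (rule continuous_on_id)
  have "compactin (product_topology (\<lambda>_. euclidean) UNIV) (PiE UNIV (\<lambda>x. if x \<in> A then {0..1::real} else {0}))"
    unfolding compactin_PiE by auto
  moreover have "closed {\<gamma> :: 'x \<Rightarrow> real. sum \<gamma> A = 1}"
    by (intro closed_Collect_eq continuous_intros cont)
  ultimately have comp: "compact S"
    unfolding S_def by (intro compact_Int_closed) (simp_all add: euclidean_product_topology)
  obtain a where "a \<in> A" using assms by auto
  then have "(\<lambda>x. if x = a then 1 else 0) \<in> S" using assms by (simp add: S_def PiE_iff)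
  then have ne: "S \<noteq> {}" by blast
  have "continuous_on S (\<lambda>\<gamma>. if b then \<gamma> x *\<^sub>R u x else 0)" for b x
    by (cases b; simp; intro continuous_intros cont)
  then have "continuous_on S (spread A u r \<phi>)"
    unfolding spread_def deviation_def class_sum_def by (intro continuous_intros)
  from continuous_attains_inf[OF comp ne this] obtain \<gamma> where \<gamma>: "\<gamma> \<in> S"
    "\<And>\<delta>. \<delta> \<in> S \<Longrightarrow> spread A u r \<phi> \<gamma> \<le> spread A u r \<phi> \<delta>" by blast
  have "spread A u r \<phi> \<gamma> \<le> spread A u r \<phi> \<delta>" if \<delta>: "\<forall>x\<in>A. \<delta> x \<ge> 0" "sum \<delta> A = 1" for \<delta>
  proof -
    have "\<delta> x \<le> 1" if "x \<in> A" for x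
      using member_le_sum[of x A \<delta>] that \<delta> assms by auto
    then have "(\<lambda>x. if x \<in> A then \<delta> x else 0) \<in> S" using \<delta> by (auto simp: S_def)
    moreover have "spread A u r \<phi> (\<lambda>x. if x \<in> A then \<delta> x else 0) = spread A u r \<phi> \<delta>"
      unfolding spread_def by (simp add: deviation_cong[of A "\<lambda>x. if x \<in> A then \<delta> x else 0" \<delta> \<phi> \<phi>])
    ultimately show ?thesis using \<gamma>(2) by metis
  qed
  moreover have "\<gamma> x \<ge> 0" if "x \<in> A" for x
  proof -
    have "\<gamma> x \<in> (if x \<in> A then {0..1} else {0})" using \<gamma>(1) unfolding S_def by (blast dest: PiE_mem)
    then show ?thesis using that by simp
  qed
  moreover have "sum \<gamma> A = 1" using \<gamma>(1) by (simp add: S_def)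
  ultimately show ?thesis by blast
qed


text \<open>Only finitely many colourings of \<open>A\<close> differ on \<open>A\<close>, so the
  best of the minima for fixed colourings is a global minimum.\<close>

lemma exists_min_spread:
  fixes u :: "'x \<Rightarrow> 'a::real_inner"
  assumes "finite A" "A \<noteq> {}" "r \<ge> 1"
  shows "\<exists>\<phi> \<gamma>. (\<forall>x\<in>A. \<phi> x \<in> {1..r}) \<and> (\<forall>x\<in>A. \<gamma> x \<ge> 0) \<and> sum \<gamma> A = 1 \<and>
    (\<forall>\<psi> \<delta>. (\<forall>x\<in>A. \<psi> x \<in> {1..r}) \<and> (\<forall>x\<in>A. \<delta> x \<ge> 0) \<and> sum \<delta> A = 1
       \<longrightarrow> spread A u r \<phi> \<gamma> \<le> spread A u r \<psi> \<delta>)"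
proof -
  obtain m where m: "\<And>\<phi>. (\<forall>x\<in>A. m \<phi> x \<ge> 0) \<and> sum (m \<phi>) A = 1"
    and min: "\<And>\<phi> \<delta>. \<forall>x\<in>A. \<delta> x \<ge> 0 \<Longrightarrow> sum \<delta> A = 1 \<Longrightarrow> spread A u r \<phi> (m \<phi>) \<le> spread A u r \<phi> \<delta>"
    using spread_attains_min[OF assms(1,2), of u r] by metis
  define \<Phi> where "\<Phi> = PiE A (\<lambda>_. {1..r})"
  have "finite \<Phi>" "\<Phi> \<noteq> {}" using assms by (auto simp: \<Phi>_def PiE_eq_empty_iff intro: finite_PiE)
  then obtain \<phi> where \<phi>: "\<phi> \<in> \<Phi>" "\<And>\<psi>. \<psi> \<in> \<Phi> \<Longrightarrow> spread A u r \<phi> (m \<phi>) \<le> spread A u r \<psi> (m \<psi>)"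
    using ex_min_if_finite[of "(\<lambda>\<psi>. spread A u r \<psi> (m \<psi>)) ` \<Phi>"] by (fastforce simp: not_less)
  have "spread A u r \<phi> (m \<phi>) \<le> spread A u r \<psi> \<delta>"
    if "\<forall>x\<in>A. \<psi> x \<in> {1..r}" "\<forall>x\<in>A. \<delta> x \<ge> 0" "sum \<delta> A = 1" for \<psi> \<delta>
  proof -
    have "restrict \<psi> A \<in> \<Phi>" using that by (auto simp: \<Phi>_def)
    then have "spread A u r \<phi> (m \<phi>) \<le> spread A u r (restrict \<psi> A) \<delta>"
      using \<phi>(2) min[OF that(2,3)] by (meson order_trans)
    also have "\<dots> = spread A u r \<psi> \<delta>"
      unfolding spread_def by (simp add: deviation_cong[of A \<delta> \<delta> "restrict \<psi> A" \<psi>])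
    finally show ?thesis .
  qed
  moreover have "\<forall>x\<in>A. \<phi> x \<in> {1..r}" using \<phi>(1) by (auto simp: \<Phi>_def PiE_iff)
  ultimately show ?thesis using m by blast
qed

section \<open>The conic form of Tverberg's theorem\<close>

text \<open>Take a minimum of the spread. If it were positive, no optimal pair could have a weight
  zero. But the number of points leaves a direction \<open>\<delta>\<close> in which all deviations,
  and hence optimality, stay unchanged, and following it makes some weight vanish. So the deviations
  are zero and all class sums agree; the half-space condition on \<open>h\<close> keeps the common
  value away from 0.\<close>

lemma conic_tverberg:
  fixes u :: "'x \<Rightarrow> 'a::euclidean_space"
  assumes fin: "finite A" and r: "r \<ge> 1" and card: "card A > (r - 1) * DIM('a)"
    and h: "\<And>x. x \<in> A \<Longrightarrow> h \<bullet> u x > 0"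
  shows "\<exists>\<phi> \<gamma> w. (\<forall>x\<in>A. \<phi> x \<in> {1..r}) \<and> (\<forall>x\<in>A. \<gamma> x \<ge> 0) \<and> w \<noteq> 0 \<and>
    (\<forall>j\<in>{1..r}. class_sum A u \<phi> \<gamma> j = w)"
proof -
  define feas where "feas = (\<lambda>(\<phi> :: 'x \<Rightarrow> nat) (\<gamma> :: 'x \<Rightarrow> real).
    (\<forall>x\<in>A. \<phi> x \<in> {1..r}) \<and> (\<forall>x\<in>A. \<gamma> x \<ge> 0) \<and> sum \<gamma> A = 1)"
  define opt where "opt = (\<lambda>\<phi> \<gamma>. feas \<phi> \<gamma> \<and> (\<forall>\<psi> \<delta>. feas \<psi> \<delta> \<longrightarrow> spread A u r \<phi> \<gamma> \<le> spread A u r \<psi> \<delta>))"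
  have "A \<noteq> {}" using card by auto
  then obtain \<phi> \<gamma> where opt: "opt \<phi> \<gamma>"
    using exists_min_spread[OF fin _ r, of u] unfolding opt_def feas_def by metis
  have transfer: "opt \<phi>' \<gamma>'"
    if "opt \<phi> \<gamma>" "feas \<phi>' \<gamma>'" "\<And>j. j \<in> {1..r} \<Longrightarrow> deviation A u r \<phi>' \<gamma>' j = deviation A u r \<phi> \<gamma> j"
    for \<phi> \<phi>' \<gamma> \<gamma>'
  proof -
    have "spread A u r \<phi>' \<gamma>' = spread A u r \<phi> \<gamma>"
      unfolding spread_def by (rule sum.cong) (auto simp: that(3))
    then show ?thesis using that unfolding opt_def by auto
  qed
  \<comment> \<open>Compare the optimum with the segment towards the point mass \<open>e\<close> at
    \<open>x\<close>.\<close>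
  have ge: "spread A u r \<phi> \<gamma> \<le> deviation A u r \<phi> \<gamma> (\<phi> x) \<bullet> u x" if o: "opt \<phi> \<gamma>" and x: "x \<in> A" for \<phi> \<gamma> x
  proof -
    define e where "e = (\<lambda>y. if y = x then 1 else 0 :: real)"
    have f: "feas \<phi> \<gamma>" using o by (simp add: opt_def)
    have "spread A u r \<phi> \<gamma> \<le> (\<Sum>j\<in>{1..r}. deviation A u r \<phi> \<gamma> j \<bullet> deviation A u r \<phi> e j)"
      unfolding spread_def
    proof (rule nearest_point_inner_ge)
      fix \<epsilon> :: real assume \<epsilon>: "0 < \<epsilon>" "\<epsilon> \<le> 1"
      have "(\<Sum>y\<in>A. (1 - \<epsilon>) * \<gamma> y + \<epsilon> * e y) = (1 - \<epsilon>) * sum \<gamma> A + \<epsilon> * sum e A"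
        by (simp add: sum.distrib sum_distrib_left)
      also have "\<dots> = 1" using f fin x by (simp add: feas_def e_def)
      finally have "feas \<phi> (\<lambda>y. (1 - \<epsilon>) * \<gamma> y + \<epsilon> * e y)"
        using f \<epsilon> by (simp add: feas_def e_def)
      then have "spread A u r \<phi> \<gamma> \<le> spread A u r \<phi> (\<lambda>y. (1 - \<epsilon>) * \<gamma> y + \<epsilon> * e y)"
        using o by (simp add: opt_def)
      then show "(\<Sum>j = 1..r. deviation A u r \<phi> \<gamma> j \<bullet> deviation A u r \<phi> \<gamma> j)
        \<le> (\<Sum>j = 1..r. ((1 - \<epsilon>) *\<^sub>R deviation A u r \<phi> \<gamma> j + \<epsilon> *\<^sub>R deviation A u r \<phi> e j) \<bullet>
            ((1 - \<epsilon>) *\<^sub>R deviation A u r \<phi> \<gamma> j + \<epsilon> *\<^sub>R deviation A u r \<phi> e j))"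
        unfolding spread_def deviation_linear .
    qed
    also have "\<dots> = (\<Sum>y\<in>A. e y * (deviation A u r \<phi> \<gamma> (\<phi> y) \<bullet> u y))"
      using f by (intro sum_inner_deviation fin sum_deviation r) (auto simp: feas_def)
    also have "\<dots> = (\<Sum>y\<in>A. if y = x then deviation A u r \<phi> \<gamma> (\<phi> y) \<bullet> u y else 0)"
      by (rule sum.cong) (auto simp: e_def)
    also have "\<dots> = deviation A u r \<phi> \<gamma> (\<phi> x) \<bullet> u x"
      using fin x by simp
    finally show ?thesis .
  qed
  \<comment> \<open>A point of weight zero can change its class for free, and some class contradicts \<open>ge\<close>.\<close>
  have boundary: "spread A u r \<phi> \<gamma> \<le> 0" if o: "opt \<phi> \<gamma>" and x: "x \<in> A" "\<gamma> x = 0" for \<phi> \<gamma> x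
  proof -
    have "(\<Sum>k\<in>{1..r}. deviation A u r \<phi> \<gamma> k \<bullet> u x) = 0"
      unfolding inner_sum_left[symmetric] sum_deviation[OF r] by simp
    then obtain k where k: "k \<in> {1..r}" "deviation A u r \<phi> \<gamma> k \<bullet> u x \<le> 0"
      using r sum_pos[of "{1..r}" "\<lambda>k. deviation A u r \<phi> \<gamma> k \<bullet> u x"] by (force simp: not_le)
    have dev: "deviation A u r (\<phi>(x := k)) \<gamma> = deviation A u r \<phi> \<gamma>"
      by (rule deviation_cong) (auto simp: x)
    have "opt (\<phi>(x := k)) \<gamma>"
      using o k by (intro transfer[OF o]) (auto simp: dev opt_def feas_def)
    from ge[OF this x(1)] have "spread A u r \<phi> \<gamma> \<le> deviation A u r \<phi> \<gamma> k \<bullet> u x"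
      unfolding spread_def dev by simp
    then show ?thesis using k by linarith
  qed
  have "spread A u r \<phi> \<gamma> \<le> 0"
  proof (rule ccontr)
    assume "\<not> spread A u r \<phi> \<gamma> \<le> 0"
    then have \<mu>: "spread A u r \<phi> \<gamma> > 0" by simp
    have f: "feas \<phi> \<gamma>" using opt by (simp add: opt_def)
    have pos: "\<gamma> x > 0" if "x \<in> A" for x
      using boundary[OF opt that] f that \<mu> by (force simp: feas_def less_le)
    have tot: "(\<Sum>x\<in>A. \<delta> x * (deviation A u r \<phi> \<gamma> (\<phi> x) \<bullet> u x))
        = (\<Sum>j\<in>{1..r}. deviation A u r \<phi> \<gamma> j \<bullet> deviation A u r \<phi> \<delta> j)" for \<delta>
      using f by (intro sum_inner_deviation[symmetric] fin sum_deviation r) (auto simp: feas_def)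
    \<comment> \<open>The inner products at the points are each at least the spread, and their
      average with the positive weights \<open>\<gamma>\<close> equals it, so each of them equals
      the spread.\<close>
    have "(\<Sum>x\<in>A. \<gamma> x * (deviation A u r \<phi> \<gamma> (\<phi> x) \<bullet> u x - spread A u r \<phi> \<gamma>))
        = (\<Sum>x\<in>A. \<gamma> x * (deviation A u r \<phi> \<gamma> (\<phi> x) \<bullet> u x)) - sum \<gamma> A * spread A u r \<phi> \<gamma>"
      by (simp add: right_diff_distrib sum_subtractf sum_distrib_right)
    also have "\<dots> = 0" using f unfolding tot by (simp add: spread_def feas_def)
    finally have sum_eq: "(\<Sum>x\<in>A. \<gamma> x * (deviation A u r \<phi> \<gamma> (\<phi> x) \<bullet> u x - spread A u r \<phi> \<gamma>)) = 0" .
    have "\<And>x. x \<in> A \<Longrightarrow> 0 \<le> \<gamma> x * (deviation A u r \<phi> \<gamma> (\<phi> x) \<bullet> u x - spread A u r \<phi> \<gamma>)"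
      using pos ge[OF opt] by (simp add: less_imp_le)
    from sum_nonneg_eq_0_iff[OF fin this] sum_eq
    have eq: "deviation A u r \<phi> \<gamma> (\<phi> x) \<bullet> u x = spread A u r \<phi> \<gamma>" if "x \<in> A" for x
      using pos that by fastforce
    \<comment> \<open>One equation per coordinate and per class other than 1: together they make all
      class sums of \<open>\<delta>\<close> equal, and there are fewer of them than points.\<close>
    define E where "E = {2..r} \<times> (Basis :: 'a set)"
    have "card E < card A" using card by (simp add: E_def card_cartesian_product)
    then obtain \<delta> where nz: "\<exists>x\<in>A. \<delta> x \<noteq> 0" and \<delta>: "\<And>j b. j \<in> {2..r} \<Longrightarrow> b \<in> Basis \<Longrightarrow>
        (\<Sum>x\<in>A. ((if \<phi> x = j then u x \<bullet> b else 0) - (if \<phi> x = 1 then u x \<bullet> b else 0)) * \<delta> x) = 0"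
      using underdetermined_system[of E A
        "\<lambda>(j, b) x. (if \<phi> x = j then u x \<bullet> b else 0) - (if \<phi> x = 1 then u x \<bullet> b else 0)"] fin
      by (force simp: E_def)
    have const: "class_sum A u \<phi> \<delta> j = class_sum A u \<phi> \<delta> 1" if "j \<in> {1..r}" for j
    proof (cases "j = 1")
      case False
      show ?thesis
      proof (rule euclidean_eqI)
        fix b :: 'a assume "b \<in> Basis"
        have "(class_sum A u \<phi> \<delta> j - class_sum A u \<phi> \<delta> 1) \<bullet> b
          = (\<Sum>x\<in>A. ((if \<phi> x = j then u x \<bullet> b else 0) - (if \<phi> x = 1 then u x \<bullet> b else 0)) * \<delta> x)"
          unfolding class_sum_def sum_subtractf[symmetric] inner_sum_left
          by (rule sum.cong) (auto simp: inner_diff_left)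
        also have "\<dots> = 0" using False that \<open>b \<in> Basis\<close> by (intro \<delta>) auto
        finally show "class_sum A u \<phi> \<delta> j \<bullet> b = class_sum A u \<phi> \<delta> 1 \<bullet> b"
          by (simp add: inner_diff_left)
      qed
    qed simp
    have dev0: "deviation A u r \<phi> \<delta> j = 0" if "j \<in> {1..r}" for j
      using deviation_eq_0[OF r const that] .
    \<comment> \<open>Total weight 0 has two uses: \<open>\<gamma> + t * \<delta>\<close> keeps
      total weight 1, and the nonzero \<open>\<delta>\<close> must take a negative value.\<close>
    have "sum \<delta> A * spread A u r \<phi> \<gamma> = (\<Sum>x\<in>A. \<delta> x * (deviation A u r \<phi> \<gamma> (\<phi> x) \<bullet> u x))"
      by (simp add: sum_distrib_right eq)
    also have "\<dots> = 0" unfolding tot by (simp add: dev0)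
    finally have sum0: "sum \<delta> A = 0" using \<mu> by simp
    have "\<exists>x\<in>A. \<delta> x < 0"
    proof (rule ccontr)
      assume "\<not> ?thesis"
      then have "\<And>x. x \<in> A \<Longrightarrow> 0 \<le> \<delta> x" by (auto simp: not_less)
      from sum_nonneg_eq_0_iff[of A \<delta>, OF fin this] sum0 nz show False by blast
    qed
    then obtain t x where t: "\<forall>x\<in>A. \<gamma> x + t * \<delta> x \<ge> 0" and x: "x \<in> A" "\<gamma> x + t * \<delta> x = 0"
      using move_to_boundary[OF fin, of \<gamma> \<delta>] pos by (meson less_imp_le)
    have "opt \<phi> (\<lambda>x. 1 * \<gamma> x + t * \<delta> x)"
    proof (rule transfer[OF opt])
      show "feas \<phi> (\<lambda>x. 1 * \<gamma> x + t * \<delta> x)"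
        using f t sum0 by (simp add: feas_def sum.distrib sum_distrib_left[symmetric])
      show "deviation A u r \<phi> (\<lambda>x. 1 * \<gamma> x + t * \<delta> x) j = deviation A u r \<phi> \<gamma> j" if "j \<in> {1..r}" for j
        unfolding deviation_linear dev0[OF that] by simp
    qed
    from boundary[OF this x(1)] x have "spread A u r \<phi> (\<lambda>x. 1 * \<gamma> x + t * \<delta> x) \<le> 0" by simp
    moreover have "spread A u r \<phi> (\<lambda>x. 1 * \<gamma> x + t * \<delta> x) = spread A u r \<phi> \<gamma>"
      unfolding spread_def deviation_linear by (rule sum.cong) (auto simp: dev0)
    ultimately show False using \<mu> by simp
  qed
  moreover have "spread A u r \<phi> \<gamma> \<ge> 0" unfolding spread_def by (intro sum_nonneg) simp
  ultimately have "spread A u r \<phi> \<gamma> = 0" by linarith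
  then have dev: "deviation A u r \<phi> \<gamma> j = 0" if "j \<in> {1..r}" for j
    unfolding spread_def using that by (subst (asm) sum_nonneg_eq_0_iff) auto
  define w where "w = (1 / real r) *\<^sub>R (\<Sum>k\<in>{1..r}. class_sum A u \<phi> \<gamma> k)"
  have w: "class_sum A u \<phi> \<gamma> j = w" if "j \<in> {1..r}" for j
    using dev[OF that] by (simp add: deviation_def w_def)
  have f: "feas \<phi> \<gamma>" using opt by (simp add: opt_def)
  \<comment> \<open>If \<open>w\<close> were 0, pairing with \<open>h\<close> would turn it into a
    vanishing sum of nonnegative terms and force all weights to 0, against their total 1.\<close>
  have "w \<noteq> 0"
  proof
    assume "w = 0"
    have "(\<Sum>x\<in>A. \<gamma> x * (h \<bullet> u x)) = (\<Sum>j\<in>{1..r}. h \<bullet> class_sum A u \<phi> \<gamma> j)"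
      using f by (intro sum_inner_class_sum[symmetric] fin) (auto simp: feas_def)
    also have "\<dots> = 0" using w \<open>w = 0\<close> by simp
    finally have sum0: "(\<Sum>x\<in>A. \<gamma> x * (h \<bullet> u x)) = 0" .
    have "\<And>x. x \<in> A \<Longrightarrow> 0 \<le> \<gamma> x * (h \<bullet> u x)" using f h by (simp add: feas_def less_imp_le)
    from sum_nonneg_eq_0_iff[of A "\<lambda>x. \<gamma> x * (h \<bullet> u x)", OF fin this] sum0 have "\<And>x. x \<in> A \<Longrightarrow> \<gamma> x * (h \<bullet> u x) = 0" by blast
    then have "\<gamma> x = 0" if "x \<in> A" for x using h[OF that] that by fastforce
    then show False using f by (simp add: feas_def)
  qed
  then show ?thesis using w f unfolding feas_def by blast
qed

section \<open>Caratheodory reduction and prescribed class sizes\<close>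

text \<open>Conic Caratheodory in all classes at once: take weights of least support. More than
  \<open>DIM('a)\<close> active points in one class would be linearly dependent, and moving along
  the dependence would remove one of them without changing any class sum.\<close>

lemma class_sum_small_support:
  fixes u :: "'x \<Rightarrow> 'a::euclidean_space"
  assumes fin: "finite A" and \<gamma>: "\<forall>x\<in>A. \<gamma> x \<ge> 0"
  shows "\<exists>\<delta>. (\<forall>x\<in>A. \<delta> x \<ge> 0) \<and> (\<forall>j. class_sum A u \<phi> \<delta> j = class_sum A u \<phi> \<gamma> j) \<and>
    (\<forall>j. card {x\<in>A. \<delta> x \<noteq> 0 \<and> \<phi> x = j} \<le> DIM('a))"
proof -
  define good where "good = (\<lambda>\<delta>. (\<forall>x\<in>A. \<delta> x \<ge> 0) \<and> (\<forall>j. class_sum A u \<phi> \<delta> j = class_sum A u \<phi> \<gamma> j))"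
  have "good \<gamma>" using \<gamma> by (simp add: good_def)
  then obtain \<delta> where \<delta>: "good \<delta>"
    and min: "\<And>\<eta>. good \<eta> \<Longrightarrow> card {x\<in>A. \<delta> x \<noteq> 0} \<le> card {x\<in>A. \<eta> x \<noteq> 0}"
    using ex_has_least_nat[of good \<gamma> "\<lambda>\<delta>. card {x\<in>A. \<delta> x \<noteq> 0}"] by blast
  have "card {x\<in>A. \<delta> x \<noteq> 0 \<and> \<phi> x = j} \<le> DIM('a)" for j
  proof (rule ccontr)
    define B where "B = {x\<in>A. \<delta> x \<noteq> 0 \<and> \<phi> x = j}"
    assume "\<not> card {x\<in>A. \<delta> x \<noteq> 0 \<and> \<phi> x = j} \<le> DIM('a)"
    then obtain \<eta> where \<eta>: "\<exists>x\<in>B. \<eta> x \<noteq> 0" "(\<Sum>x\<in>B. \<eta> x *\<^sub>R u x) = 0"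
      using linear_dependence_euclidean[of B u] fin by (auto simp: B_def)
    \<comment> \<open>The sign \<open>s\<close> orients the dependence so that it has a negative
      entry.\<close>
    obtain x s where xs: "x \<in> B" "s * \<eta> x < 0"
    proof -
      obtain x where "x \<in> B" "\<eta> x \<noteq> 0" using \<eta> by blast
      then show thesis using that[of x "- sgn (\<eta> x)"] by (auto simp: sgn_if split: if_splits)
    qed
    define \<theta> where "\<theta> x = (if x \<in> B then s * \<eta> x else 0)" for x
    have "class_sum A u \<phi> \<theta> k = 0" for k
    proof (cases "k = j")
      case True
      have "class_sum A u \<phi> \<theta> k = (\<Sum>x\<in>B. s *\<^sub>R (\<eta> x *\<^sub>R u x))"
        unfolding class_sum_def using fin True
        by (intro sum.mono_neutral_cong_right) (auto simp: B_def \<theta>_def)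
      then show ?thesis using \<eta> by (simp only: scaleR_sum_right[symmetric]) simp
    next
      case False
      then show ?thesis unfolding class_sum_def by (intro sum.neutral) (auto simp: B_def \<theta>_def)
    qed
    note zero = this
    have "\<exists>x\<in>A. \<theta> x < 0" using xs by (auto simp: \<theta>_def B_def)
    then obtain t y where t: "\<forall>x\<in>A. \<delta> x + t * \<theta> x \<ge> 0"
      and y: "y \<in> A" "\<theta> y < 0" "\<delta> y + t * \<theta> y = 0"
      using move_to_boundary[OF fin, of \<delta> \<theta>] \<delta> unfolding good_def by blast
    have "good (\<lambda>x. 1 * \<delta> x + t * \<theta> x)"
      using t \<delta> by (simp add: good_def class_sum_linear[of A u \<phi> 1, simplified] zero)
    from min[OF this] have "card {x\<in>A. \<delta> x \<noteq> 0} \<le> card {x\<in>A. \<delta> x + t * \<theta> x \<noteq> 0}" by simp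
    moreover have "{x\<in>A. \<delta> x + t * \<theta> x \<noteq> 0} \<subset> {x\<in>A. \<delta> x \<noteq> 0}"
      using y by (auto simp: \<theta>_def B_def split: if_splits)
    moreover have "finite {x\<in>A. \<delta> x \<noteq> 0}" using fin by simp
    ultimately show False using psubset_card_mono leD by blast
  qed
  then show ?thesis using \<delta> unfolding good_def by blast
qed

lemma card_eq_sum_class_cards:
  assumes "finite A" "finite J" "\<And>x. x \<in> A \<Longrightarrow> \<phi> x \<in> J"
  shows "(\<Sum>j\<in>J. card {x\<in>A. \<phi> x = j}) = card A"
  using sum.group[of A J \<phi> "\<lambda>_. 1 :: nat"] assms by (simp add: image_subset_iff)

text \<open>Greedy: as long as a point is left, the capacities exceed the number of coloured points
  in total, so some class has room. It serves to distribute the points of weight zero.\<close>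

lemma extend_coloring:
  assumes "finite C" "finite B" "finite J" "B \<inter> C = {}"
    and "\<forall>x\<in>B. \<phi> x \<in> J" "\<forall>j\<in>J. card {x\<in>B. \<phi> x = j} \<le> m j" "card (B \<union> C) \<le> sum m J"
  shows "\<exists>\<psi>. (\<forall>x\<in>B. \<psi> x = \<phi> x) \<and> (\<forall>x\<in>B \<union> C. \<psi> x \<in> J) \<and> (\<forall>j\<in>J. card {x\<in>B \<union> C. \<psi> x = j} \<le> m j)"
  using assms
proof (induction C rule: finite_induct)
  case empty
  then show ?case by (intro exI[of _ \<phi>]) auto
next
  case (insert c C)
  have "card (B \<union> insert c C) = Suc (card (B \<union> C))" using insert by simp
  with insert obtain \<psi> where \<psi>: "\<forall>x\<in>B. \<psi> x = \<phi> x" "\<forall>x\<in>B \<union> C. \<psi> x \<in> J"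
      "\<forall>j\<in>J. card {x\<in>B \<union> C. \<psi> x = j} \<le> m j" and less: "card (B \<union> C) < sum m J"
    by auto
  have "\<exists>k\<in>J. card {x\<in>B \<union> C. \<psi> x = k} < m k"
  proof (rule ccontr)
    assume "\<not> ?thesis"
    then have "sum m J \<le> (\<Sum>j\<in>J. card {x\<in>B \<union> C. \<psi> x = j})" by (intro sum_mono) (auto simp: not_less)
    then show False using card_eq_sum_class_cards[of "B \<union> C" J \<psi>] insert \<psi> less by auto
  qed
  then obtain k where k: "k \<in> J" "card {x\<in>B \<union> C. \<psi> x = k} < m k" by blast
  have "card {x\<in>B \<union> insert c C. (\<psi>(c := k)) x = j} \<le> m j" if "j \<in> J" for j
  proof (cases "j = k")
    case True
    then have "{x\<in>B \<union> insert c C. (\<psi>(c := k)) x = j} = insert c {x\<in>B \<union> C. \<psi> x = k}"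
      using insert by auto
    then show ?thesis using True k insert by (simp add: card_insert_if)
  next
    case False
    then have "{x\<in>B \<union> insert c C. (\<psi>(c := k)) x = j} = {x\<in>B \<union> C. \<psi> x = j}"
      using insert by auto
    then show ?thesis using \<psi>(3) that by simp
  qed
  then show ?case using \<psi> k insert by (intro exI[of _ "\<psi>(c := k)"]) auto
qed

text \<open>When the capacities add up to exactly the number of points, all upper bounds are
  attained.\<close>

lemma coloring_with_class_sizes:
  assumes "finite S" "finite J" "sum m J = card S"
  shows "\<exists>\<kappa>. (\<forall>s\<in>S. \<kappa> s \<in> J) \<and> (\<forall>j\<in>J. card {s\<in>S. \<kappa> s = j} = m j)"
proof -
  obtain \<kappa> where \<kappa>: "\<forall>s\<in>S. \<kappa> s \<in> J" "\<forall>j\<in>J. card {s\<in>S. \<kappa> s = j} \<le> m j"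
    using extend_coloring[of S "{}" J undefined m] assms by auto
  have "(\<Sum>j\<in>J. card {s\<in>S. \<kappa> s = j}) = sum m J"
    using card_eq_sum_class_cards[of S J \<kappa>] assms \<kappa> by simp
  then have "card {s\<in>S. \<kappa> s = j} = m j" if "j \<in> J" for j
    using sum_mono_inv[of "\<lambda>j. card {s\<in>S. \<kappa> s = j}" J m j] \<kappa> assms that by auto
  then show ?thesis using \<kappa> by blast
qed


section \<open>Rational polynomials and generic points\<close>

definition monomial :: "'i set \<Rightarrow> ('i \<Rightarrow> nat) \<Rightarrow> ('i \<Rightarrow> real) \<Rightarrow> real" where
  "monomial I e f = (\<Prod>i\<in>I. f i ^ e i)"

text \<open>A list of terms may repeat an exponent vector. Sums and products then become
  concatenation and pairwise products of lists, and like terms are collected only when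
  \<open>alg_indep\<close> is applied.\<close>

definition rat_polynomial :: "'i set \<Rightarrow> (('i \<Rightarrow> real) \<Rightarrow> real) \<Rightarrow> bool" where
  "rat_polynomial I g \<longleftrightarrow> (\<exists>ts :: (rat \<times> ('i \<Rightarrow> nat)) list.
     (\<forall>(c, e)\<in>set ts. \<forall>i. i \<notin> I \<longrightarrow> e i = 0) \<and>
     (\<forall>f. g f = (\<Sum>(c, e)\<leftarrow>ts. of_rat c * monomial I e f)))"

lemma rat_polynomial_const: "rat_polynomial I (\<lambda>f. of_rat c)"
  unfolding rat_polynomial_def by (intro exI[of _ "[(c, \<lambda>_. 0)]"]) (simp add: monomial_def)

lemma rat_polynomial_var:
  assumes "finite I" "k \<in> I"
  shows "rat_polynomial I (\<lambda>f. f k)"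
proof -
  have "monomial I (\<lambda>i. if i = k then 1 else 0) f = f k" for f
  proof -
    have "monomial I (\<lambda>i. if i = k then 1 else 0) f = (\<Prod>i\<in>I. if i = k then f i else 1)"
      unfolding monomial_def by (rule prod.cong) auto
    then show ?thesis using assms by simp
  qed
  then show ?thesis unfolding rat_polynomial_def
    using assms by (intro exI[of _ "[(1, \<lambda>i. if i = k then 1 else 0)]"]) auto
qed

lemma rat_polynomial_add:
  assumes "rat_polynomial I g" "rat_polynomial I h"
  shows "rat_polynomial I (\<lambda>f. g f + h f)"
proof -
  obtain ts us where "\<forall>(c, e)\<in>set ts. \<forall>i. i \<notin> I \<longrightarrow> e i = 0" "\<forall>f. g f = (\<Sum>(c, e)\<leftarrow>ts. of_rat c * monomial I e f)"
    "\<forall>(c, e)\<in>set us. \<forall>i. i \<notin> I \<longrightarrow> e i = 0" "\<forall>f. h f = (\<Sum>(c, e)\<leftarrow>us. of_rat c * monomial I e f)"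
    using assms unfolding rat_polynomial_def by auto
  then show ?thesis unfolding rat_polynomial_def by (intro exI[of _ "ts @ us"]) auto
qed

lemma sum_list_mult_monomials:
  "(\<Sum>(c, e)\<leftarrow>ts. of_rat c * monomial I e f) * (\<Sum>(c, e)\<leftarrow>us. of_rat c * monomial I e f)
   = (\<Sum>(c, e)\<leftarrow>map (\<lambda>((c, e), (d, e')). (c * d, \<lambda>i. e i + e' i)) (List.product ts us). of_rat c * monomial I e f)"
proof (induction ts)
  case (Cons t ts)
  have "(case t of (c, e) \<Rightarrow> of_rat c * monomial I e f) * (\<Sum>(c, e)\<leftarrow>us. of_rat c * monomial I e f)
    = (\<Sum>(c, e)\<leftarrow>map (\<lambda>((c, e), (d, e')). (c * d, \<lambda>i. e i + e' i)) (map (Pair t) us). of_rat c * monomial I e f)"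
    by (induction us)
      (auto simp: algebra_simps of_rat_mult monomial_def power_add prod.distrib split: prod.splits)
  then show ?case using Cons by (simp add: algebra_simps)
qed simp

lemma rat_polynomial_mult:
  assumes "rat_polynomial I g" "rat_polynomial I h"
  shows "rat_polynomial I (\<lambda>f. g f * h f)"
proof -
  obtain ts us where "\<forall>(c, e)\<in>set ts. \<forall>i. i \<notin> I \<longrightarrow> e i = 0" "\<forall>f. g f = (\<Sum>(c, e)\<leftarrow>ts. of_rat c * monomial I e f)"
    "\<forall>(c, e)\<in>set us. \<forall>i. i \<notin> I \<longrightarrow> e i = 0" "\<forall>f. h f = (\<Sum>(c, e)\<leftarrow>us. of_rat c * monomial I e f)"
    using assms unfolding rat_polynomial_def by auto
  then show ?thesis unfolding rat_polynomial_def
    by (intro exI[of _ "map (\<lambda>((c, e), (d, e')). (c * d, \<lambda>i. e i + e' i)) (List.product ts us)"])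
       (fastforce simp: sum_list_mult_monomials[symmetric] simp del: map_map)
qed

lemma rat_polynomial_diff:
  assumes "rat_polynomial I g" "rat_polynomial I h"
  shows "rat_polynomial I (\<lambda>f. g f - h f)"
  using rat_polynomial_add[OF assms(1) rat_polynomial_mult[OF rat_polynomial_const[of I "-1"] assms(2)]]
  by (simp add: of_rat_minus)

lemma rat_polynomial_zero: "rat_polynomial I (\<lambda>f. 0)"
  and rat_polynomial_one: "rat_polynomial I (\<lambda>f. 1)"
  using rat_polynomial_const[of I 0] rat_polynomial_const[of I 1] by simp_all

lemma rat_polynomial_if:
  "rat_polynomial I g \<Longrightarrow> rat_polynomial I h \<Longrightarrow> rat_polynomial I (\<lambda>f. if b then g f else h f)"
  by (cases b) simp_all

text \<open>Collecting like terms yields the coefficient function that \<open>alg_indep\<close>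
  speaks about.\<close>

lemma sum_list_monomials_collect:
  "(\<Sum>(c, e)\<leftarrow>ts. of_rat c * monomial I e f)
   = (\<Sum>e\<in>snd ` set ts. of_rat (\<Sum>(c, e')\<leftarrow>ts. if e' = e then c else 0) * monomial I e f)"
proof -
  \<comment> \<open>Any finite superset \<open>S\<close> of the exponents is allowed, since the
    exponent set itself changes along the induction on the list.\<close>
  have "(\<Sum>(c, e)\<leftarrow>ts. of_rat c * monomial I e f)
    = (\<Sum>e\<in>S. of_rat (\<Sum>(c, e')\<leftarrow>ts. if e' = e then c else 0) * monomial I e f)"
    if "snd ` set ts \<subseteq> S" "finite S" for S
    using that
  proof (induction ts)
    case (Cons t ts)
    obtain c e where t: "t = (c, e)" by force
    have "(\<Sum>e'\<in>S. of_rat (\<Sum>(c, e'')\<leftarrow>t # ts. if e'' = e' then c else 0) * monomial I e' f)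
      = (\<Sum>e'\<in>S. (if e = e' then of_rat c * monomial I e' f else 0)
          + of_rat (\<Sum>(c, e'')\<leftarrow>ts. if e'' = e' then c else 0) * monomial I e' f)"
      by (rule sum.cong) (auto simp: t of_rat_add algebra_simps)
    also have "\<dots> = of_rat c * monomial I e f
        + (\<Sum>e'\<in>S. of_rat (\<Sum>(c, e'')\<leftarrow>ts. if e'' = e' then c else 0) * monomial I e' f)"
      using Cons.prems by (simp add: sum.distrib t)
    finally show ?case using Cons by (simp add: t)
  qed simp
  then show ?thesis by simp
qed

text \<open>All collected coefficients must be zero. Used in contrapositive form: a value that is
  nonzero at one special point is nonzero at the generic point.\<close>

lemma alg_indep_rat_polynomial_zero:
  assumes "alg_indep f I" "rat_polynomial I g" "g f = 0"
  shows "g f' = 0"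
proof -
  obtain ts where ts: "\<forall>(c, e)\<in>set ts. \<forall>i. i \<notin> I \<longrightarrow> e i = 0"
    and g: "\<And>f. g f = (\<Sum>(c, e)\<leftarrow>ts. of_rat c * monomial I e f)"
    using assms(2) unfolding rat_polynomial_def by auto
  define a where "a e = (\<Sum>(c, e')\<leftarrow>ts. if e' = e then c else 0)" for e
  have supp: "e \<in> snd ` set ts" if "a e \<noteq> 0" for e
  proof (rule ccontr)
    assume "e \<notin> snd ` set ts"
    then have zero: "map (\<lambda>(c, e'). if e' = e then c else 0) ts = map (\<lambda>_. 0) ts" by (force intro: map_cong)
    have "a e = 0" unfolding a_def zero by simp
    with that show False by simp
  qed
  then have fin: "finite {e. a e \<noteq> 0}" by (rule finite_subset[of _ "snd ` set ts", OF subsetI]) auto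
  have eval: "g f = (\<Sum>e\<in>{e. a e \<noteq> 0}. of_rat (a e) * (\<Prod>i\<in>I. f i ^ e i))" for f
    unfolding g sum_list_monomials_collect a_def[symmetric] monomial_def[symmetric]
    using supp by (intro sum.mono_neutral_right) auto
  have "a e = 0" for e
  proof -
    have "\<forall>e. a e \<noteq> 0 \<longrightarrow> (\<forall>i. i \<notin> I \<longrightarrow> e i = 0)" using supp ts by fastforce
    moreover have "(\<Sum>e\<in>{e. a e \<noteq> 0}. of_rat (a e) * (\<Prod>i\<in>I. f i ^ e i)) = 0"
      using assms(3) eval by simp
    ultimately show ?thesis using assms(1) fin unfolding alg_indep_def by blast
  qed
  then show ?thesis using eval by simp
qed

text \<open>Triviality of the kernel of a matrix with polynomial entries, given as a set of rows, is
  inherited by a generic point from any other point, by elimination: a pivot that is nonzero at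
  the special point stays nonzero at the generic one.\<close>

lemma generic_trivial_kernel:
  fixes R :: "(('i \<Rightarrow> real) \<Rightarrow> 'u \<Rightarrow> real) set"
  assumes gen: "alg_indep f I" and fin: "finite U"
    and poly: "\<And>\<rho> u. \<rho> \<in> R \<Longrightarrow> u \<in> U \<Longrightarrow> rat_polynomial I (\<lambda>f. \<rho> f u)"
    and triv: "\<And>\<alpha>. \<forall>\<rho>\<in>R. (\<Sum>u\<in>U. \<rho> f' u * \<alpha> u) = 0 \<Longrightarrow> \<forall>u\<in>U. \<alpha> u = 0"
    and ker: "\<forall>\<rho>\<in>R. (\<Sum>u\<in>U. \<rho> f u * \<alpha> u) = 0"
  shows "\<forall>u\<in>U. \<alpha> u = 0"
  using fin poly triv ker
proof (induction U arbitrary: R rule: finite_induct)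
  case (insert v U)
  \<comment> \<open>Without a pivot the unit vector at \<open>v\<close> would lie in the kernel at
    \<open>f'\<close>.\<close>
  have "\<exists>\<pi>\<in>R. \<pi> f' v \<noteq> 0"
  proof (rule ccontr)
    assume "\<not> ?thesis"
    then have "\<forall>\<rho>\<in>R. (\<Sum>u\<in>insert v U. \<rho> f' u * (if u = v then 1 else 0)) = 0"
      by (intro ballI sum.neutral) auto
    from insert.prems(2)[OF this] show False by simp
  qed
  then obtain \<pi> where \<pi>: "\<pi> \<in> R" "\<pi> f' v \<noteq> 0" by blast
  have \<pi>0: "\<pi> f v \<noteq> 0"
    using alg_indep_rat_polynomial_zero[OF gen insert.prems(1)[OF \<pi>(1), of v]] \<pi>(2) by blast
  define elim where "elim \<rho> = (\<lambda>f u. \<pi> f v * \<rho> f u - \<rho> f v * \<pi> f u)" for \<rho>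
  have elim: "(\<Sum>u\<in>U. elim \<rho> f u * \<alpha> u)
     = \<pi> f v * (\<Sum>u\<in>insert v U. \<rho> f u * \<alpha> u) - \<rho> f v * (\<Sum>u\<in>insert v U. \<pi> f u * \<alpha> u)" for \<rho> f \<alpha>
    using sum_eliminate_pivot[of "insert v U" v "\<pi> f" "\<rho> f" \<alpha>] insert.hyps by (simp add: elim_def)
  have U: "\<forall>u\<in>U. \<alpha> u = 0"
  proof (rule insert.IH[of "elim ` R"])
    show "rat_polynomial I (\<lambda>f. \<rho> f u)" if "\<rho> \<in> elim ` R" "u \<in> U" for \<rho> u
      using that \<pi> insert.prems(1)
      by (auto simp: elim_def intro!: rat_polynomial_diff rat_polynomial_mult)
    show "\<forall>\<rho>\<in>elim ` R. (\<Sum>u\<in>U. \<rho> f u * \<alpha> u) = 0"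
      using insert.prems(3) \<pi> by (simp add: elim)
    show "\<forall>u\<in>U. \<alpha> u = 0" if ker: "\<forall>\<rho>\<in>elim ` R. (\<Sum>u\<in>U. \<rho> f' u * \<alpha> u) = 0" for \<alpha>
    proof -
      \<comment> \<open>A kernel vector of the eliminated rows at \<open>f'\<close> is extended to
        \<open>v\<close> by solving the pivot row, which makes it a kernel vector of all of
        \<open>R\<close>.\<close>
      define \<beta> where "\<beta> = \<alpha>(v := - (\<Sum>u\<in>U. \<pi> f' u * \<alpha> u) / \<pi> f' v)"
      have \<beta>: "(\<Sum>u\<in>U. \<rho> f' u * \<beta> u) = (\<Sum>u\<in>U. \<rho> f' u * \<alpha> u)" for \<rho>
        using insert.hyps by (intro sum.cong) (auto simp: \<beta>_def)
      have p: "(\<Sum>u\<in>insert v U. \<pi> f' u * \<beta> u) = 0"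
        using insert.hyps \<beta>[of \<pi>] \<pi>(2) by (simp add: \<beta>_def)
      have "(\<Sum>u\<in>insert v U. \<rho> f' u * \<beta> u) = 0" if "\<rho> \<in> R" for \<rho>
        using elim[of \<rho> f' \<beta>] p \<pi>(2) ker that \<beta>[of "elim \<rho>"] by simp
      then have "\<forall>u\<in>insert v U. \<beta> u = 0" using insert.prems(2) by blast
      then show ?thesis using insert.hyps by (auto simp: \<beta>_def split: if_splits)
    qed
  qed
  have "(\<Sum>u\<in>insert v U. \<pi> f u * \<alpha> u) = \<pi> f v * \<alpha> v" using insert.hyps U by simp
  then have "\<alpha> v = 0" using insert.prems(3) \<pi>(1) \<pi>0 by simp
  with U show ?case by simp
qed simp


section \<open>Generic points admit no degenerate Tverberg weights\<close>

text \<open>Equal class sums and class totals amount to \<open>(r - 1) * (CARD('d) + 1)\<close>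
  homogeneous equations, and the degeneracy \<open>zero\<close> adds one more, so there are as many
  equations as unknowns. By \<open>generic_trivial_kernel\<close> it suffices that a special
  configuration with the same colouring admits only the zero solution.\<close>

lemma generic_tverberg_nonzero:
  fixes A :: "(real ^ 'd) set"
  assumes fin: "finite A" and r: "r \<ge> 1" and card: "card A = (r - 1) * (CARD('d) + 1) + 1"
    and gen: "alg_indep (\<lambda>(x, i). x $ i) (A \<times> (UNIV :: 'd set))"
    and \<phi>: "\<And>x. x \<in> A \<Longrightarrow> \<phi> x \<in> {1..r}"
    and small: "\<And>j. j \<in> {1..r} \<Longrightarrow> card {x\<in>A. \<phi> x = j} \<le> CARD('d) + 1"
    and ne: "\<And>j. j \<in> {1..r} \<Longrightarrow> {x\<in>A. \<phi> x = j} \<noteq> {}"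
    and z: "\<And>j. j \<in> {1..r} \<Longrightarrow> (\<Sum>x\<in>{x\<in>A. \<phi> x = j}. \<alpha> x *\<^sub>R x) = z"
    and t: "\<And>j. j \<in> {1..r} \<Longrightarrow> (\<Sum>x\<in>{x\<in>A. \<phi> x = j}. \<alpha> x) = t"
    and zero: "t = 0 \<or> (\<exists>x\<in>A. \<alpha> x = 0)"
  shows "\<forall>x\<in>A. \<alpha> x = 0"
proof -
  \<comment> \<open>The codimension of the affine hull of class \<open>j\<close> in general
    position. These codimensions add up to the dimension, so the coordinates can be coloured by
    \<open>\<kappa>\<close> with exactly \<open>c j\<close> of colour \<open>j\<close>.\<close>
  define c where "c j = CARD('d) + 1 - card {x\<in>A. \<phi> x = j}" for j
  have pos: "card {x\<in>A. \<phi> x = j} > 0" if "j \<in> {1..r}" for j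
    using ne[OF that] fin by (simp add: card_gt_0_iff)
  have "sum c {1..r} = r * (CARD('d) + 1) - card A"
    unfolding c_def using small card_eq_sum_class_cards[of A "{1..r}" \<phi>, OF fin _ \<phi>]
    by (subst sum_subtractf_nat) auto
  also have "\<dots> = CARD('d)" using r by (cases r) (auto simp: card)
  finally obtain \<kappa> where \<kappa>: "\<And>i :: 'd. \<kappa> i \<in> {1..r}" and c: "\<And>j. j \<in> {1..r} \<Longrightarrow> card {i. \<kappa> i = j} = c j"
    using coloring_with_class_sizes[of "UNIV :: 'd set" "{1..r}" c] by (auto simp del: atLeastAtMost_iff)
  \<comment> \<open>The points of class \<open>j\<close> are labelled by the coordinates of other
    colours and one extra label \<open>None\<close>; the count is
    \<open>1 + CARD('d) - c j\<close>.\<close>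
  have "\<exists>b. bij_betw b {x\<in>A. \<phi> x = j} (insert None (Some ` {i. \<kappa> i \<noteq> j}))" if j: "j \<in> {1..r}" for j
  proof (rule finite_same_card_bij)
    have "card {i. \<kappa> i \<noteq> j} = CARD('d) - c j"
      using c[OF j] by (simp add: Collect_neg_eq Compl_eq_Diff_UNIV card_Diff_subset)
    then show "card {x\<in>A. \<phi> x = j} = card (insert None (Some ` {i. \<kappa> i \<noteq> j}))"
      using pos[OF j] small[OF j] by (simp add: card_image c_def)
  qed (use fin in auto)
  then have "\<forall>j\<in>{1..r}. \<exists>b. bij_betw b {x\<in>A. \<phi> x = j} (insert None (Some ` {i. \<kappa> i \<noteq> j}))" by blast
  from bchoice[OF this] obtain b
    where b: "\<And>j. j \<in> {1..r} \<Longrightarrow> bij_betw (b j) {x\<in>A. \<phi> x = j} (insert None (Some ` {i. \<kappa> i \<noteq> j}))"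
    by blast
  \<comment> \<open>In the special configuration class \<open>j\<close> consists of the unit vectors \<open>e\<^sub>i\<close> with \<open>\<kappa> i \<noteq> j\<close> and of
    minus their sum, so its affine hull is the coordinate flat where the coordinates of colour \<open>j\<close>
    vanish; these flats meet only in the origin, the barycentre of every class.\<close>
  define f' :: "(real ^ 'd) \<times> 'd \<Rightarrow> real" where
    "f' = (\<lambda>(x, i). case b (\<phi> x) x of None \<Rightarrow> if \<kappa> i = \<phi> x then 0 else - 1 | Some k \<Rightarrow> if k = i then 1 else 0)"
  obtain y where y: "t \<noteq> 0 \<Longrightarrow> y \<in> A \<and> \<alpha> y = 0" using zero by blast
  \<comment> \<open>Comparing each class with class 1 removes the unknown common values
    \<open>z\<close> and \<open>t\<close> from the system.\<close>
  define \<rho> :: "nat \<Rightarrow> 'd \<Rightarrow> ((real ^ 'd) \<times> 'd \<Rightarrow> real) \<Rightarrow> real ^ 'd \<Rightarrow> real"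
    where "\<rho> j i = (\<lambda>f x. (if \<phi> x = j then f (x, i) else 0) - (if \<phi> x = 1 then f (x, i) else 0))" for j i
  define \<sigma> :: "nat \<Rightarrow> ((real ^ 'd) \<times> 'd \<Rightarrow> real) \<Rightarrow> real ^ 'd \<Rightarrow> real"
    where "\<sigma> j = (\<lambda>f x. (if \<phi> x = j then 1 else 0) - (if \<phi> x = 1 then 1 else 0))" for j
  \<comment> \<open>The extra equation: class 1 has total 0 if \<open>t = 0\<close>, and otherwise
    the weight of \<open>y\<close> is 0.\<close>
  define \<tau> :: "((real ^ 'd) \<times> 'd \<Rightarrow> real) \<Rightarrow> real ^ 'd \<Rightarrow> real"
    where "\<tau> = (\<lambda>f x. if t = 0 then (if \<phi> x = 1 then 1 else 0) else (if x = y then 1 else 0))"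
  define R where "R = {\<rho> j i | j i. j \<in> {1..r}} \<union> \<sigma> ` {1..r} \<union> {\<tau>}"
  define S where "S f \<alpha> j i = (\<Sum>x\<in>A. (if \<phi> x = j then f (x, i) else 0) * \<alpha> x)"
    for f :: "(real ^ 'd) \<times> 'd \<Rightarrow> real" and \<alpha> :: "real ^ 'd \<Rightarrow> real" and j i
  define T where "T \<alpha> j = (\<Sum>x\<in>A. (if \<phi> x = j then 1 else 0) * \<alpha> x)" for \<alpha> :: "real ^ 'd \<Rightarrow> real" and j
  have \<rho>: "(\<Sum>x\<in>A. \<rho> j i f x * \<alpha> x) = S f \<alpha> j i - S f \<alpha> 1 i" for j i f \<alpha>
    unfolding \<rho>_def S_def left_diff_distrib sum_subtractf ..
  have \<sigma>: "(\<Sum>x\<in>A. \<sigma> j f x * \<alpha> x) = T \<alpha> j - T \<alpha> 1" for j f \<alpha>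
    unfolding \<sigma>_def T_def left_diff_distrib sum_subtractf ..
  have \<tau>: "(\<Sum>x\<in>A. \<tau> f x * \<alpha> x) = (if t = 0 then T \<alpha> 1 else \<alpha> y)" for f \<alpha>
  proof (cases "t = 0")
    case False
    have "(\<Sum>x\<in>A. \<tau> f x * \<alpha> x) = (\<Sum>x\<in>A. if x = y then \<alpha> x else 0)"
      using False by (intro sum.cong) (auto simp: \<tau>_def)
    then show ?thesis using y False fin by simp
  qed (simp add: \<tau>_def T_def)
  have T: "T \<alpha> j = (\<Sum>x\<in>{x\<in>A. \<phi> x = j}. \<alpha> x)" for \<alpha> j
    unfolding T_def using fin by (intro sum.mono_neutral_cong_right) auto
  have 1: "1 \<in> {1..r}" using r by simp
  show ?thesis
  proof (rule generic_trivial_kernel[OF gen fin, of R])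
    fix \<eta> x assume "\<eta> \<in> R" "x \<in> A"
    have coord: "rat_polynomial (A \<times> UNIV) (\<lambda>f. f (x, i))" for i :: 'd
      using fin \<open>x \<in> A\<close> by (intro rat_polynomial_var) auto
    have "rat_polynomial (A \<times> (UNIV :: 'd set)) (\<lambda>f. \<rho> j i f x)" for j i
      unfolding \<rho>_def by (intro rat_polynomial_diff rat_polynomial_if rat_polynomial_zero rat_polynomial_one coord)
    moreover have "rat_polynomial (A \<times> (UNIV :: 'd set)) (\<lambda>f. \<sigma> j f x)" for j
      unfolding \<sigma>_def by (intro rat_polynomial_diff rat_polynomial_if rat_polynomial_zero rat_polynomial_one)
    moreover have "rat_polynomial (A \<times> (UNIV :: 'd set)) (\<lambda>f. \<tau> f x)"
      unfolding \<tau>_def by (intro rat_polynomial_if rat_polynomial_zero rat_polynomial_one)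
    ultimately show "rat_polynomial (A \<times> UNIV) (\<lambda>f. \<eta> f x)"
      using \<open>\<eta> \<in> R\<close> unfolding R_def by auto
  next
    have "S (\<lambda>(x, i). x $ i) \<alpha> j i = z $ i" if "j \<in> {1..r}" for j i
    proof -
      have "z $ i = (\<Sum>x\<in>{x\<in>A. \<phi> x = j}. x $ i * \<alpha> x)"
        unfolding z[OF that, symmetric] by (simp add: mult.commute)
      also have "\<dots> = S (\<lambda>(x, i). x $ i) \<alpha> j i"
        unfolding S_def using fin by (intro sum.mono_neutral_cong_left) auto
      finally show ?thesis by simp
    qed
    then show "\<forall>\<eta>\<in>R. (\<Sum>x\<in>A. \<eta> (\<lambda>(x, i). x $ i) x * \<alpha> x) = 0"
      using t 1 y by (auto simp: R_def \<rho> \<sigma> \<tau> T)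
  next
    fix \<alpha> assume ker: "\<forall>\<eta>\<in>R. (\<Sum>x\<in>A. \<eta> f' x * \<alpha> x) = 0"
    have S1: "S f' \<alpha> j i = S f' \<alpha> 1 i" and T1: "T \<alpha> j = T \<alpha> 1" if "j \<in> {1..r}" for j i
    proof -
      have "\<rho> j i \<in> R" "\<sigma> j \<in> R" using that by (auto simp: R_def)
      then have "(\<Sum>x\<in>A. \<rho> j i f' x * \<alpha> x) = 0" "(\<Sum>x\<in>A. \<sigma> j f' x * \<alpha> x) = 0" using ker by blast+
      then show "S f' \<alpha> j i = S f' \<alpha> 1 i" "T \<alpha> j = T \<alpha> 1" unfolding \<rho> \<sigma> by simp_all
    qed
    have extra: "(if t = 0 then T \<alpha> 1 else \<alpha> y) = 0"
      using ker unfolding R_def \<tau>[symmetric, of \<alpha> f'] by blast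
    \<comment> \<open>Coordinate \<open>i\<close> vanishes on the class of colour
      \<open>\<kappa> i\<close>, and all classes share the same sum.\<close>
    have "S f' \<alpha> (\<kappa> i) i = 0" for i
      unfolding S_def
    proof (intro sum.neutral ballI)
      fix x assume "x \<in> A"
      then have "b (\<phi> x) x \<in> insert None (Some ` {i. \<kappa> i \<noteq> \<phi> x})"
        using bij_betwE[OF b[OF \<phi>]] by blast
      then show "(if \<phi> x = \<kappa> i then f' (x, i) else 0) * \<alpha> x = 0" by (auto simp: f'_def)
    qed
    then have S0: "S f' \<alpha> j i = 0" if "j \<in> {1..r}" for j i
      using S1[OF that, of i] S1[OF \<kappa>, of i i] by simp
    \<comment> \<open>In coordinate \<open>i\<close> only the unit vector \<open>x\<close> and the
      negative sum \<open>p\<close> of class \<open>j\<close> contribute, with values 1 and -1, so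
      their weights agree.\<close>
    have const: "\<exists>a. \<forall>x\<in>{x\<in>A. \<phi> x = j}. \<alpha> x = a" if j: "j \<in> {1..r}" for j
    proof -
      have "None \<in> b j ` {x\<in>A. \<phi> x = j}" using bij_betw_imp_surj_on[OF b[OF j]] by simp
      then obtain p where p: "p \<in> A" "\<phi> p = j" "b j p = None" by auto
      have "\<alpha> x = \<alpha> p" if x: "x \<in> A" "\<phi> x = j" for x
      proof (cases "b j x")
        case None
        then show ?thesis using inj_onD[OF bij_betw_imp_inj_on[OF b[OF j]], of x p] p x by simp
      next
        case (Some i)
        have i: "\<kappa> i \<noteq> j" using bij_betwE[OF b[OF j]] x Some by fastforce
        have "x \<noteq> p" using Some p by auto
        have "S f' \<alpha> j i = (\<Sum>w\<in>{x, p}. f' (w, i) * \<alpha> w)"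
          unfolding S_def
        proof (rule sum.mono_neutral_cong_right)
          show "\<forall>w\<in>A - {x, p}. (if \<phi> w = j then f' (w, i) else 0) * \<alpha> w = 0"
          proof
            fix w assume w: "w \<in> A - {x, p}"
            have "b j w \<noteq> None" "b j w \<noteq> Some i" if "\<phi> w = j"
              using inj_onD[OF bij_betw_imp_inj_on[OF b[OF j]], of w p]
                inj_onD[OF bij_betw_imp_inj_on[OF b[OF j]], of w x] p x w Some that by auto
            then show "(if \<phi> w = j then f' (w, i) else 0) * \<alpha> w = 0" by (auto simp: f'_def)
          qed
        qed (use fin p x in auto)
        also have "\<dots> = \<alpha> x - \<alpha> p" using \<open>x \<noteq> p\<close> p x i Some by (simp add: f'_def)
        finally show ?thesis using S0[OF j] by simp
      qed
      then show ?thesis by blast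
    qed
    then obtain a where a: "\<And>x. x \<in> A \<Longrightarrow> \<alpha> x = a (\<phi> x)" using \<phi> by (metis (mono_tags, lifting) mem_Collect_eq)
    have Ta: "T \<alpha> j = card {x\<in>A. \<phi> x = j} * a j" for j
      unfolding T using a by simp
    \<comment> \<open>All totals equal \<open>T \<alpha> 1\<close>, and each is the class size times
      the constant weight, so either form of the extra equation makes every constant 0.\<close>
    have "T \<alpha> 1 = 0"
    proof (cases "t = 0")
      case False
      then have "a (\<phi> y) = 0" "y \<in> A" using extra y a by auto
      then show ?thesis using T1[OF \<phi>, of y] Ta[of "\<phi> y"] by simp
    qed (use extra in simp)
    then have "a j = 0" if "j \<in> {1..r}" for j
      using T1[OF that] Ta[of j] pos[OF that] by simp
    then show "\<forall>x\<in>A. \<alpha> x = 0" using a \<phi> by simp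
  qed
qed

section \<open>From a separating hyperplane to the sign pattern of the solution\<close>

theorem mainTheorem4:
  fixes r :: nat and A M :: "(real ^ 'd) set"
  assumes "r \<ge> 2"
    and "finite A"
    and "card A = (r - 1) * (CARD('d) + 1) + 1"
    and "alg_indep (\<lambda>(x, i). x $ i) (A \<times> (UNIV :: 'd set))"
    and "M \<subseteq> A"
    and "convex hull M \<inter> convex hull (A - M) = {}"
  shows "\<exists>(P :: nat \<Rightarrow> (real ^ 'd) set) (z :: real ^ 'd) (\<alpha> :: real ^ 'd \<Rightarrow> real).
           (\<forall>j\<in>{1..r}. P j \<noteq> {} \<and> P j \<subseteq> A)
         \<and> (\<forall>j\<in>{1..r}. \<forall>k\<in>{1..r}. j \<noteq> k \<longrightarrow> P j \<inter> P k = {})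
         \<and> (\<Union>j\<in>{1..r}. P j) = A
         \<and> (\<forall>j\<in>{1..r}. z = (\<Sum>x\<in>P j. \<alpha> x *\<^sub>R x) \<and> (\<Sum>x\<in>P j. \<alpha> x) = 1)
         \<and> ((\<forall>x\<in>A. \<alpha> x < 0 \<longleftrightarrow> x \<in> M) \<or> (\<forall>x\<in>A. \<alpha> x < 0 \<longleftrightarrow> x \<notin> M))"
proof -
  have r: "r \<ge> 1" using assms(1) by simp
  have finM: "finite M" using assms finite_subset by blast
  have "\<exists>a \<beta>. (\<forall>x\<in>convex hull M. a \<bullet> x < \<beta>) \<and> (\<forall>x\<in>convex hull (A - M). a \<bullet> x > \<beta>)"
  proof (cases "M = {}")
    case True
    \<comment> \<open>With \<open>M\<close> empty a constant affine function is enough, as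
      \<open>0 > - 1\<close> on all of \<open>A\<close>.\<close>
    then show ?thesis by (intro exI[of _ 0] exI[of _ "- 1"]) auto
  next
    case False
    then show ?thesis
      using assms finM by (intro separating_hyperplane_compact_closed)
        (auto simp: finite_imp_compact_convex_hull compact_imp_closed)
  qed
  then obtain a \<beta> where M: "\<And>x. x \<in> convex hull M \<Longrightarrow> a \<bullet> x < \<beta>"
    and AM: "\<And>x. x \<in> convex hull (A - M) \<Longrightarrow> a \<bullet> x > \<beta>" by blast
  define s :: "real ^ 'd \<Rightarrow> real" where "s x = (if x \<in> M then - 1 else 1)" for x
  define u :: "real ^ 'd \<Rightarrow> (real ^ 'd) \<times> real" where "u x = s x *\<^sub>R (x, 1)" for x
  have DIM: "DIM((real ^ 'd) \<times> real) = CARD('d) + 1" by simp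
  \<comment> \<open>The pairing is \<open>s x * (a \<bullet> x - \<beta>)\<close>, and the sign
    \<open>s x\<close> matches the side of the hyperplane on which \<open>x\<close> lies.\<close>
  have pos: "(a, - \<beta>) \<bullet> u x > 0" if "x \<in> A" for x
    using M[OF hull_inc, of x] AM[OF hull_inc, of x] that by (auto simp: u_def s_def)
  obtain \<phi> \<gamma>' w where \<phi>: "\<forall>x\<in>A. \<phi> x \<in> {1..r}" and \<gamma>': "\<forall>x\<in>A. \<gamma>' x \<ge> 0" and w: "w \<noteq> 0"
    and cs': "\<forall>j\<in>{1..r}. class_sum A u \<phi> \<gamma>' j = w"
    using conic_tverberg[where u = u and h = "(a, - \<beta>)", OF assms(2) r _ pos] unfolding DIM using assms(3) by auto
  obtain \<gamma> where \<gamma>: "\<forall>x\<in>A. \<gamma> x \<ge> 0" and cs: "\<forall>j\<in>{1..r}. class_sum A u \<phi> \<gamma> j = w"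
    and small: "\<And>j. card {x\<in>A. \<gamma> x \<noteq> 0 \<and> \<phi> x = j} \<le> CARD('d) + 1"
    using class_sum_small_support[OF assms(2) \<gamma>', of u \<phi>] cs' unfolding DIM by auto
  define B where "B = {x\<in>A. \<gamma> x \<noteq> 0}"
  have B: "finite B" "B \<union> (A - B) = A" "\<And>j. {x\<in>B. \<phi> x = j} = {x\<in>A. \<gamma> x \<noteq> 0 \<and> \<phi> x = j}"
    using assms(2) by (auto simp: B_def)
  \<comment> \<open>The \<open>r\<close> classes have enough room to recolour the points outside the
    support \<open>B\<close> while no class exceeds \<open>CARD('d) + 1\<close> points; their weight
    is zero, so no class sum changes.\<close>
  have "card A \<le> (\<Sum>j\<in>{1..r}. CARD('d) + 1)" using r by (cases r) (auto simp: assms(3))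
  then obtain \<psi> where \<psi>B: "\<forall>x\<in>B. \<psi> x = \<phi> x" and \<psi>: "\<forall>x\<in>A. \<psi> x \<in> {1..r}"
    and \<psi>small: "\<forall>j\<in>{1..r}. card {x\<in>A. \<psi> x = j} \<le> CARD('d) + 1"
    using extend_coloring[of "A - B" B "{1..r}" \<phi> "\<lambda>_. CARD('d) + 1", unfolded B(2,3)]
      assms(2) B(1,2) \<phi> small by blast
  have sumw: "(\<Sum>x\<in>{x\<in>A. \<psi> x = j}. \<gamma> x *\<^sub>R u x) = w" if "j \<in> {1..r}" for j
  proof -
    have "class_sum A u \<psi> \<gamma> j = class_sum A u \<phi> \<gamma> j"
      using \<psi>B by (intro class_sum_cong) (auto simp: B_def)
    then show ?thesis unfolding class_sum_eq[OF assms(2), symmetric] using cs that by simp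
  qed
  obtain z t where zt: "w = (z, t)" by force
  have z: "(\<Sum>x\<in>{x\<in>A. \<psi> x = j}. (\<gamma> x * s x) *\<^sub>R x) = z"
    and t: "(\<Sum>x\<in>{x\<in>A. \<psi> x = j}. \<gamma> x * s x) = t" if "j \<in> {1..r}" for j
    using arg_cong[OF sumw[OF that], of fst] arg_cong[OF sumw[OF that], of snd]
    by (auto simp: zt u_def fst_sum snd_sum)
  \<comment> \<open>An empty class would have sum 0, but every class sum is
    \<open>w\<close>.\<close>
  have ne: "{x\<in>A. \<psi> x = j} \<noteq> {}" if "j \<in> {1..r}" for j
    using sumw[OF that] w by (metis sum.empty)
  \<comment> \<open>In the degenerate case all weights would vanish and hence
    \<open>w = (z, t)\<close> would be 0.\<close>
  have "\<not> (t = 0 \<or> (\<exists>x\<in>A. \<gamma> x * s x = 0))"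
  proof
    assume "t = 0 \<or> (\<exists>x\<in>A. \<gamma> x * s x = 0)"
    from generic_tverberg_nonzero[OF assms(2) r assms(3,4) _ _ ne z t this] \<psi> \<psi>small
    have "\<forall>x\<in>A. \<gamma> x * s x = 0" by blast
    then have "(\<Sum>x\<in>{x\<in>A. \<psi> x = 1}. (\<gamma> x * s x) *\<^sub>R x) = 0" "(\<Sum>x\<in>{x\<in>A. \<psi> x = 1}. \<gamma> x * s x) = 0"
      by (intro sum.neutral ballI; simp)+
    then have "z = 0" "t = 0" using z[of 1] t[of 1] r by simp_all
    then show False using w zt by (simp add: zero_prod_def)
  qed
  then have t0: "t \<noteq> 0" and \<gamma>pos: "\<And>x. x \<in> A \<Longrightarrow> \<gamma> x > 0" using \<gamma> by (auto simp: less_le)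
  define \<alpha> where "\<alpha> x = \<gamma> x * s x / t" for x
  have sol: "(1 / t) *\<^sub>R z = (\<Sum>x\<in>{x\<in>A. \<psi> x = j}. \<alpha> x *\<^sub>R x)" "(\<Sum>x\<in>{x\<in>A. \<psi> x = j}. \<alpha> x) = 1"
    if "j \<in> {1..r}" for j
    using z[OF that] t[OF that] t0
    by (auto simp: \<alpha>_def scaleR_sum_right sum_divide_distrib[symmetric])
  have sign: "(\<forall>x\<in>A. \<alpha> x < 0 \<longleftrightarrow> x \<in> M) \<or> (\<forall>x\<in>A. \<alpha> x < 0 \<longleftrightarrow> x \<notin> M)"
  proof (cases "t > 0")
    case True
    then have "\<forall>x\<in>A. \<alpha> x < 0 \<longleftrightarrow> x \<in> M"
      using \<gamma>pos by (force simp: \<alpha>_def s_def divide_less_0_iff)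
    then show ?thesis ..
  next
    case False
    then have "\<forall>x\<in>A. \<alpha> x < 0 \<longleftrightarrow> x \<notin> M"
      using \<gamma>pos t0 by (force simp: \<alpha>_def s_def divide_less_0_iff)
    then show ?thesis ..
  qed
  show ?thesis
    by (rule exI[of _ "\<lambda>j. {x\<in>A. \<psi> x = j}"], rule exI[of _ "(1 / t) *\<^sub>R z"], rule exI[of _ \<alpha>])
       (use \<psi> ne sol sign in auto)
qed

end
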